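(* Let $T:[0,1)\to[0,1)$ be the map $$T(x)=\frac{1}{2\left[\frac{1}{1-x}\right]+1-\frac{1}{1-x}}.$$ If $x\in[0,1)$ has (infinite) backward continued fraction expansion $x=[a_1,a_2,a_3,\dots]$, then $$T(x)=[\underbrace{2,2,\dots,2}_{(a_1-2)\text{ times}},\,a_2+1,\,a_3,\,a_4,\dots].$$
   Context: For real $y$, $[y]$ denotes the integer part (floor) of $y$. Backward continued fractions: for a sequence $(a_i)_{i\ge1}$ of integers $a_i\ge2$, write $$[a_1,a_2,a_3,\dots]=1-\cfrac{1}{a_1-\cfrac{1}{a_2-\cfrac{1}{a_3-\cdots}}}\in[0,1),$$ understood as the limit of the finite truncations. Every $x\in[0,1)$ has exactly one infinite expansion of this form with all $a_i\ge2$ (irrational numbers are those whose sequence is not eventually constant equal to $2$; rational numbers are those whose infinite sequence ends with a tail of $2$'s). Convention: for rational numbers the infinite expansion is always used. *)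

theory Defs
  imports Complex_Main "HOL-Library.Stream"
begin

text \<open>For a stream \<open>s\<close> with entries \<open>a\<^sub>1, a\<^sub>2, \<dots>\<close>, \<open>bcf_denom n s\<close> is
  \<open>a\<^sub>1 - 1/(a\<^sub>2 - 1/(\<dots> - 1/a\<^sub>m))\<close> with \<open>m = n + 1\<close>. If all entries are at least 2,
  this number exceeds 1, so no division by zero occurs.\<close>

primrec bcf_denom :: "nat \<Rightarrow> int stream \<Rightarrow> real" where
  "bcf_denom 0 s = of_int (shd s)"
| "bcf_denom (Suc n) s = of_int (shd s) - 1 / bcf_denom n (stl s)"

definition bcf_trunc :: "int stream \<Rightarrow> nat \<Rightarrow> real" where
  "bcf_trunc s n = 1 - 1 / bcf_denom n s"

text \<open>\<open>x = [a\<^sub>1, a\<^sub>2, a\<^sub>3, \<dots>]\<close> with integers \<open>a\<^sub>i \<ge> 2\<close>. Streams are infinite,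
  so this is always the infinite expansion, also for rational \<open>x\<close>.\<close>

definition has_bcf_expansion :: "real \<Rightarrow> int stream \<Rightarrow> bool" where
  "has_bcf_expansion x s \<longleftrightarrow> (\<forall>a\<in>sset s. a \<ge> 2) \<and> bcf_trunc s \<longlonglongrightarrow> x"

text \<open>Only the values on \<open>[0,1)\<close> are meaningful.\<close>

definition bcf_map :: "real \<Rightarrow> real" where
  "bcf_map x = 1 / (2 * of_int \<lfloor>1 / (1 - x)\<rfloor> + 1 - 1 / (1 - x))"

end

(*
  Let d(a) be the limit of the denominators a1 - 1/(a2 - ...), so that d = 1/(1 - x), and
  put u = 1/d(a2, a3, ...), which lies in (0, 1]. Then d(a1, a2, ...) = a1 - u has integer
  part a1 - 1, whence T(x) = 1/(a1 - 1 + u). On the other side d(a2 + 1, a3, ...) = (1 + u)/u,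
  and each prepended entry 2 turns (k + 1 + u)/(k + u) into (k + 2 + u)/(k + 1 + u); after
  a1 - 2 steps this equals 1/(1 - T(x)).
*)
theory Submission
  imports Defs
begin

lemma bcf_denom_gt_1:
  assumes "\<forall>a\<in>sset s. a \<ge> 2"
  shows "bcf_denom n s > 1"
  using assms
proof (induction n arbitrary: s)
  case 0
  then have "shd s \<ge> 2" by (simp add: shd_sset)
  then show ?case by simp
next
  case (Suc n)
  have "bcf_denom n (stl s) > 1"
    using Suc.prems by (intro Suc.IH) (auto dest: stl_sset)
  then have "1 / bcf_denom n (stl s) < 1" by simp
  moreover have "shd s \<ge> 2" using Suc.prems by (simp add: shd_sset)
  ultimately show ?case by simp
qed

text \<open>Gives the bound \<open>1 / shd s\<close> from below for the reciprocals, uniform in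
  \<open>n\<close>, which keeps their limit away from 0.\<close>

lemma bcf_denom_le_shd:
  assumes "\<forall>a\<in>sset s. a \<ge> 2"
  shows "bcf_denom n s \<le> of_int (shd s)"
proof (cases n)
  case (Suc m)
  have "bcf_denom m (stl s) > 1"
    using assms by (intro bcf_denom_gt_1) (auto dest: stl_sset)
  then show ?thesis using Suc by simp
qed simp

lemma bcf_denom_add_shd: "bcf_denom n ((a + b) ## s) = bcf_denom n (a ## s) + of_int b"
  by (cases n) simp_all

lemma bcf_denom_tendsto_SCons:
  assumes "(\<lambda>n. bcf_denom n s) \<longlonglongrightarrow> d" and "d \<noteq> 0"
  shows "(\<lambda>n. bcf_denom n (a ## s)) \<longlonglongrightarrow> of_int a - 1 / d"
proof -
  have "(\<lambda>n. bcf_denom (Suc n) (a ## s)) \<longlonglongrightarrow> of_int a - 1 / d"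
    using assms by (auto intro!: tendsto_intros)
  then show ?thesis by (rule LIMSEQ_imp_Suc)
qed

text \<open>\<open>1 - 1 / d\<close> and \<open>1 / (1 - x)\<close> are mutually inverse, also at
  \<open>d = 0\<close> since \<open>1 / 0 = 0\<close>. Both limits pass through by continuity, as
  \<open>1 - x\<close> and its reciprocal are nonzero.\<close>

lemma bcf_trunc_tendsto_iff:
  assumes "x \<noteq> 1"
  shows "bcf_trunc s \<longlonglongrightarrow> x \<longleftrightarrow> (\<lambda>n. bcf_denom n s) \<longlonglongrightarrow> 1 / (1 - x)"
proof
  assume "bcf_trunc s \<longlonglongrightarrow> x"
  then have "(\<lambda>n. 1 / (1 - bcf_trunc s n)) \<longlonglongrightarrow> 1 / (1 - x)"
    using assms by (auto intro!: tendsto_intros)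
  then show "(\<lambda>n. bcf_denom n s) \<longlonglongrightarrow> 1 / (1 - x)" by (simp add: bcf_trunc_def)
next
  assume "(\<lambda>n. bcf_denom n s) \<longlonglongrightarrow> 1 / (1 - x)"
  then have "(\<lambda>n. 1 - 1 / bcf_denom n s) \<longlonglongrightarrow> 1 - 1 / (1 / (1 - x))"
    using assms by (intro tendsto_intros) auto
  then show "bcf_trunc s \<longlonglongrightarrow> x" by (simp add: bcf_trunc_def[abs_def])
qed

lemma bcf_denom_tendsto_replicate_2:
  fixes u :: real
  assumes "(\<lambda>n. bcf_denom n s) \<longlonglongrightarrow> (1 + u) / u" and "u > 0"
  shows "(\<lambda>n. bcf_denom n (replicate k 2 @- s)) \<longlonglongrightarrow> (of_nat k + 1 + u) / (of_nat k + u)"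
proof (induction k)
  case 0
  then show ?case using assms by simp
next
  case (Suc k)
  have "(of_nat k + 1 + u) / (of_nat k + u) \<noteq> 0" using \<open>u > 0\<close> by (simp add: add_nonneg_eq_0_iff)
  from bcf_denom_tendsto_SCons[OF Suc this, of 2]
  have "(\<lambda>n. bcf_denom n (replicate (Suc k) 2 @- s))
      \<longlonglongrightarrow> 2 - 1 / ((of_nat k + 1 + u) / (of_nat k + u))" by simp
  also have "2 - 1 / ((of_nat k + 1 + u) / (of_nat k + u))
      = (of_nat (Suc k) + 1 + u) / (of_nat (Suc k) + u)"
    using \<open>u > 0\<close> by (simp add: field_simps add_pos_nonneg)
  finally show ?case .
qed

theorem theorem2p6:
  fixes x :: real and a1 a2 :: int and s :: "int stream"
  assumes "x \<in> {0..<1}"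
    and "has_bcf_expansion x (a1 ## a2 ## s)"
  shows "bcf_map x \<in> {0..<1} \<and>
    has_bcf_expansion (bcf_map x) (replicate (nat (a1 - 2)) 2 @- (a2 + 1) ## s)"
proof -
  have entries: "a1 \<ge> 2" "a2 \<ge> 2" "\<forall>a\<in>sset s. a \<ge> 2"
    and lim_x: "bcf_trunc (a1 ## a2 ## s) \<longlonglongrightarrow> x"
    using assms(2) by (auto simp: has_bcf_expansion_def)
  define y where "y = 1 / (1 - x)"
  \<comment> \<open>Defined from \<open>y\<close>, so that convergence of the tail's reciprocals to
    \<open>u\<close> follows from convergence of the whole expansion.\<close>
  define u where "u = of_int a1 - y"
  let ?t = "a2 ## s"
  have t: "\<forall>a\<in>sset ?t. a \<ge> 2" using entries by simp
  have "(\<lambda>n. bcf_denom n (a1 ## ?t)) \<longlonglongrightarrow> y"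
    using lim_x assms(1) by (simp add: y_def bcf_trunc_tendsto_iff)
  then have "(\<lambda>n. of_int a1 - bcf_denom (Suc n) (a1 ## ?t)) \<longlonglongrightarrow> u"
    unfolding u_def by (intro tendsto_intros LIMSEQ_Suc)
  then have lim_u: "(\<lambda>n. 1 / bcf_denom n ?t) \<longlonglongrightarrow> u" by simp
  have "1 / bcf_denom n ?t \<le> 1" for n
    using bcf_denom_gt_1[OF t, of n] by simp
  then have "u \<le> 1" by (intro LIMSEQ_le_const2[OF lim_u]) blast
  \<comment> \<open>Positivity of the reciprocals alone would only give \<open>u \<ge> 0\<close> in
    the limit.\<close>
  have "1 / of_int a2 \<le> 1 / bcf_denom n ?t" for n
    using bcf_denom_gt_1[OF t, of n] bcf_denom_le_shd[OF t, of n] by (simp add: frac_le)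
  then have "1 / of_int a2 \<le> u" by (intro LIMSEQ_le_const[OF lim_u]) blast
  moreover have "0 < 1 / real_of_int a2" using entries by simp
  ultimately have "u > 0" by linarith
  \<comment> \<open>As \<open>0 < u \<le> 1\<close>, the number \<open>y = a1 - u\<close> lies in
    \<open>[a1 - 1, a1)\<close>; the left end is attained when \<open>u = 1\<close>.\<close>
  have "\<lfloor>y\<rfloor> = a1 - 1"
    using \<open>u > 0\<close> \<open>u \<le> 1\<close> by (intro floor_unique) (auto simp: u_def)
  then have map_x: "bcf_map x = 1 / (of_int a1 - 1 + u)"
    unfolding bcf_map_def y_def[symmetric] by (simp add: u_def algebra_simps)
  have "of_int a1 - 1 + u > 1" using entries \<open>u > 0\<close> by linarith
  then have range: "bcf_map x \<in> {0<..<1}" by (simp add: map_x)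

  \<comment> \<open>Inverting twice recovers the tail's denominators; the added 1 is the one that
    raises \<open>a2\<close> to \<open>a2 + 1\<close>.\<close>
  have "(\<lambda>n. 1 / (1 / bcf_denom n ?t) + 1) \<longlonglongrightarrow> 1 / u + 1"
    using lim_u \<open>u > 0\<close> by (intro tendsto_intros) auto
  then have "(\<lambda>n. bcf_denom n ((a2 + 1) ## s)) \<longlonglongrightarrow> (1 + u) / u"
    using \<open>u > 0\<close> by (simp add: bcf_denom_add_shd add_divide_distrib)
  then have "(\<lambda>n. bcf_denom n (replicate (nat (a1 - 2)) 2 @- (a2 + 1) ## s))
      \<longlonglongrightarrow> (of_nat (nat (a1 - 2)) + 1 + u) / (of_nat (nat (a1 - 2)) + u)"
    using \<open>u > 0\<close> by (rule bcf_denom_tendsto_replicate_2)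
  \<comment> \<open>Since \<open>a1 \<ge> 2\<close>, \<open>nat\<close> does not truncate, and both
    sides equal \<open>(a1 - 1 + u) / (a1 - 2 + u)\<close>.\<close>
  also have "(of_nat (nat (a1 - 2)) + 1 + u) / (of_nat (nat (a1 - 2)) + u) = 1 / (1 - bcf_map x)"
    using entries \<open>of_int a1 - 1 + u > 1\<close> by (simp add: map_x field_simps)
  finally have "bcf_trunc (replicate (nat (a1 - 2)) 2 @- (a2 + 1) ## s) \<longlonglongrightarrow> bcf_map x"
    using range by (simp add: bcf_trunc_tendsto_iff)
  moreover have "\<forall>a\<in>sset (replicate (nat (a1 - 2)) 2 @- (a2 + 1) ## s). a \<ge> 2"
    using entries by auto
  ultimately show ?thesis using range by (simp add: has_bcf_expansion_def)
qed

end
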